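(* Let $G$ be a finite group and let $A$, $B$ be nonempty normal subsets of $G$. Then the quotient group ${\bf C}_G(AB)/({\bf C}_G(A)\cap{\bf C}_G(B))$ is abelian.
   Context: A subset $X$ of a group $G$ is called normal if $X^g=\{g^{-1}xg\mid x\in X\}=X$ for all $g\in G$ (equivalently, $X$ is a union of conjugacy classes of $G$). For subsets $A,B$ of $G$, $AB=\{xy\mid x\in A,\ y\in B\}$. For a subset $X$ of $G$, ${\bf C}_G(X)=\{g\in G\mid g^{-1}xg=x\text{ for all }x\in X\}$ is the centralizer of $X$ in $G$. When $X$ is a normal subset, ${\bf C}_G(X)$ is a normal subgroup of $G$; also ${\bf C}_G(A)\cap{\bf C}_G(B)\subseteq{\bf C}_G(AB)$. *)

theory Defs
  imports "HOL-Algebra.Coset"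
begin

definition conj_set :: "('a, 'b) monoid_scheme \<Rightarrow> 'a set \<Rightarrow> 'a \<Rightarrow> 'a set" where
  "conj_set G X g = {inv\<^bsub>G\<^esub> g \<otimes>\<^bsub>G\<^esub> x \<otimes>\<^bsub>G\<^esub> g | x. x \<in> X}"

definition normal_subset :: "('a, 'b) monoid_scheme \<Rightarrow> 'a set \<Rightarrow> bool" where
  "normal_subset G X \<longleftrightarrow> X \<subseteq> carrier G \<and> (\<forall>g \<in> carrier G. conj_set G X g = X)"

definition centralizer :: "('a, 'b) monoid_scheme \<Rightarrow> 'a set \<Rightarrow> 'a set" where
  "centralizer G X =
     {g \<in> carrier G. \<forall>x \<in> X. inv\<^bsub>G\<^esub> g \<otimes>\<^bsub>G\<^esub> x \<otimes>\<^bsub>G\<^esub> g = x}"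

text \<open>
  The remaining lemmas show that the quotient
  \<open>(G\<lparr>carrier := centralizer G (A <#>\<^bsub>G\<^esub> B)\<rparr>) Mod (centralizer G A \<inter> centralizer G B)\<close>
  is meaningful, since \<open>Mod\<close> itself does not require a normal subgroup.
\<close>

context group
begin

lemma centralizer_iff:
  assumes "X \<subseteq> carrier G"
  shows "g \<in> centralizer G X \<longleftrightarrow> g \<in> carrier G \<and> (\<forall>x \<in> X. x \<otimes> g = g \<otimes> x)"
proof -
  have "inv g \<otimes> x \<otimes> g = x \<longleftrightarrow> x \<otimes> g = g \<otimes> x"
    if "g \<in> carrier G" "x \<in> X" for x
  proof -
    have "x \<in> carrier G"
      using that assms by blast
    then show ?thesis
      using that inv_solve_left'[of x g "x \<otimes> g"] by (simp add: m_assoc)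
  qed
  then show ?thesis
    unfolding centralizer_def by auto
qed

lemma subgroup_centralizer:
  assumes X: "X \<subseteq> carrier G"
  shows "subgroup (centralizer G X) G"
proof (rule subgroupI)
  show "centralizer G X \<subseteq> carrier G"
    by (auto simp: centralizer_def)
  have "\<one> \<in> centralizer G X"
    using X by (auto simp: centralizer_iff)
  then show "centralizer G X \<noteq> {}"
    by blast
next
  fix g assume "g \<in> centralizer G X"
  then have g: "g \<in> carrier G" "\<And>x. x \<in> X \<Longrightarrow> x \<otimes> g = g \<otimes> x"
    using X by (auto simp: centralizer_iff)
  have "x \<otimes> inv g = inv g \<otimes> x" if "x \<in> X" for x
  proof -
    have x: "x \<in> carrier G"
      using that X by blast
    then have "x = g \<otimes> x \<otimes> inv g"
      using g that by (simp add: inv_solve_right)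
    then show ?thesis
      using g x by (simp add: inv_solve_left m_assoc)
  qed
  then show "inv g \<in> centralizer G X"
    using g X by (auto simp: centralizer_iff)
next
  fix g h assume "g \<in> centralizer G X" "h \<in> centralizer G X"
  then have gh: "g \<in> carrier G" "\<And>x. x \<in> X \<Longrightarrow> x \<otimes> g = g \<otimes> x"
    "h \<in> carrier G" "\<And>x. x \<in> X \<Longrightarrow> x \<otimes> h = h \<otimes> x"
    using X by (auto simp: centralizer_iff)
  have "x \<otimes> (g \<otimes> h) = g \<otimes> h \<otimes> x" if "x \<in> X" for x
  proof -
    have x: "x \<in> carrier G"
      using that X by blast
    have "x \<otimes> (g \<otimes> h) = (x \<otimes> g) \<otimes> h"
      using gh x by (simp add: m_assoc)
    also have "\<dots> = g \<otimes> (x \<otimes> h)"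
      using gh x that by (simp add: m_assoc)
    also have "\<dots> = g \<otimes> h \<otimes> x"
      using gh x that by (simp add: m_assoc)
    finally show ?thesis .
  qed
  then show "g \<otimes> h \<in> centralizer G X"
    using gh X by (auto simp: centralizer_iff)
qed

lemma normal_centralizer:
  assumes "normal_subset G X"
  shows "centralizer G X \<lhd> G"
proof -
  have X: "X \<subseteq> carrier G" and conj: "\<And>g. g \<in> carrier G \<Longrightarrow> conj_set G X g = X"
    using assms by (auto simp: normal_subset_def)
  have "a \<otimes> h \<otimes> inv a \<in> centralizer G X"
    if a: "a \<in> carrier G" and hC: "h \<in> centralizer G X" for a h
  proof -
    have h: "h \<in> carrier G" "\<And>x. x \<in> X \<Longrightarrow> x \<otimes> h = h \<otimes> x"
      using hC X by (auto simp: centralizer_iff)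
    have "x \<otimes> (a \<otimes> h \<otimes> inv a) = a \<otimes> h \<otimes> inv a \<otimes> x" if x: "x \<in> X" for x
    proof -
      have xG: "x \<in> carrier G"
        using x X by blast
      have "inv a \<otimes> x \<otimes> a \<in> X"
        using conj[OF a] x unfolding conj_set_def by blast
      then have comm: "(inv a \<otimes> x \<otimes> a) \<otimes> h = h \<otimes> (inv a \<otimes> x \<otimes> a)"
        by (rule h)
      have cancel: "a \<otimes> (inv a \<otimes> y) = y" if "y \<in> carrier G" for y
        using a that by (simp flip: m_assoc)
      have "x \<otimes> (a \<otimes> h \<otimes> inv a) = a \<otimes> ((inv a \<otimes> x \<otimes> a) \<otimes> h) \<otimes> inv a"
        using a h(1) xG by (simp add: m_assoc cancel)
      also have "\<dots> = a \<otimes> (h \<otimes> (inv a \<otimes> x \<otimes> a)) \<otimes> inv a"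
        by (simp only: comm)
      also have "\<dots> = a \<otimes> h \<otimes> inv a \<otimes> x"
        using a h(1) xG by (simp add: m_assoc)
      finally show ?thesis .
    qed
    then show ?thesis
      using a h X by (auto simp: centralizer_iff)
  qed
  then show ?thesis
    using subgroup_centralizer[OF X] by (auto simp: normal_inv_iff)
qed

lemma centralizer_Int_subset:
  assumes "A \<subseteq> carrier G" "B \<subseteq> carrier G"
  shows "centralizer G A \<inter> centralizer G B \<subseteq> centralizer G (A <#> B)"
proof
  fix g assume "g \<in> centralizer G A \<inter> centralizer G B"
  then have g: "g \<in> carrier G" "\<And>x. x \<in> A \<Longrightarrow> x \<otimes> g = g \<otimes> x" "\<And>x. x \<in> B \<Longrightarrow> x \<otimes> g = g \<otimes> x"
    using assms by (auto simp: centralizer_iff)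
  have "(a \<otimes> b) \<otimes> g = g \<otimes> (a \<otimes> b)" if ab: "a \<in> A" "b \<in> B" for a b
  proof -
    have abG: "a \<in> carrier G" "b \<in> carrier G"
      using ab assms by blast+
    have "(a \<otimes> b) \<otimes> g = a \<otimes> (b \<otimes> g)"
      using g(1) abG by (simp add: m_assoc)
    also have "\<dots> = (a \<otimes> g) \<otimes> b"
      using g(1) g(3)[OF ab(2)] abG by (simp add: m_assoc)
    also have "\<dots> = g \<otimes> (a \<otimes> b)"
      using g(1) g(2)[OF ab(1)] abG by (simp add: m_assoc)
    finally show ?thesis .
  qed
  then show "g \<in> centralizer G (A <#> B)"
    using g(1) by (simp add: centralizer_iff set_mult_closed assms) (auto simp: set_mult_def)
qed

lemma centralizer_Int_normal:
  assumes A: "normal_subset G A" and B: "normal_subset G B"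
  shows "centralizer G A \<inter> centralizer G B \<lhd> G\<lparr>carrier := centralizer G (A <#> B)\<rparr>"
proof -
  have sub: "A \<subseteq> carrier G" "B \<subseteq> carrier G"
    using A B by (auto simp: normal_subset_def)
  have "centralizer G A \<inter> centralizer G B \<lhd> G"
    by (intro normal_subgroup_intersect normal_centralizer A B)
  moreover have "subgroup (centralizer G (A <#> B)) G"
    by (intro subgroup_centralizer set_mult_closed sub)
  ultimately show ?thesis
    using centralizer_Int_subset[OF sub] by (simp add: normal_restrict_supergroup)
qed

end

end

theory Submission
  imports Defs
begin

text \<open>
  If \<open>c\<close> centralizes \<open>AB\<close>, then \<open>inv a \<otimes> c \<otimes> a = b \<otimes> c \<otimes> inv b\<close> for all \<open>a \<in> A\<close> and \<open>b \<in> B\<close>, so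
  all elements of \<open>A\<close> induce the same automorphism \<open>\<phi>\<close> of the centralizer \<open>C\<close> of \<open>AB\<close>. As \<open>A\<close> is
  normal, \<open>\<phi>\<close> commutes with the inner automorphisms of \<open>C\<close>. Hence \<open>\<phi>\<close> moves each element of
  \<open>C\<close> only by a factor in the center of \<open>C\<close>, and therefore fixes every commutator; that is,
  commutators of \<open>C\<close> centralize \<open>A\<close>. Since \<open>AB = BA\<close>, they centralize \<open>B\<close> as well.
\<close>

context group
begin

lemma normal_subset_conj_mem:
  assumes "normal_subset G X" "x \<in> X" "g \<in> carrier G"
  shows "inv g \<otimes> x \<otimes> g \<in> X"
  using assms unfolding normal_subset_def conj_set_def by blast

lemma normal_subsetI:
  assumes X: "X \<subseteq> carrier G"
    and conj: "\<And>g x. g \<in> carrier G \<Longrightarrow> x \<in> X \<Longrightarrow> inv g \<otimes> x \<otimes> g \<in> X"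
  shows "normal_subset G X"
proof -
  have "x \<in> conj_set G X g" if "g \<in> carrier G" "x \<in> X" for g x
  proof -
    have "x \<in> carrier G"
      using that X by blast
    \<comment> \<open>Conjugation by \<open>inv g\<close> inverts conjugation by \<open>g\<close>,
      so closure under all conjugations already gives equality.\<close>
    then have "x = inv g \<otimes> (g \<otimes> x \<otimes> inv g) \<otimes> g"
      using that by (simp add: m_assoc flip: m_assoc[of "inv g" g])
    moreover have "g \<otimes> x \<otimes> inv g \<in> X"
      using conj[of "inv g" x] that by simp
    ultimately show ?thesis
      unfolding conj_set_def by blast
  qed
  moreover have "conj_set G X g \<subseteq> X" if "g \<in> carrier G" for g
    using conj that by (auto simp: conj_set_def)
  ultimately show ?thesis
    using X unfolding normal_subset_def by blast
qed

lemma normal_subset_set_mult: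
  assumes A: "normal_subset G A" and B: "normal_subset G B"
  shows "normal_subset G (A <#> B)"
proof (rule normal_subsetI)
  have sub: "A \<subseteq> carrier G" "B \<subseteq> carrier G"
    using A B by (auto simp: normal_subset_def)
  then show "A <#> B \<subseteq> carrier G"
    by (rule set_mult_closed)
  fix g x assume g: "g \<in> carrier G" and "x \<in> A <#> B"
  then obtain a b where ab: "a \<in> A" "b \<in> B" "x = a \<otimes> b"
    by (auto simp: set_mult_def)
  then have "a \<in> carrier G" "b \<in> carrier G"
    using sub by auto
  then have "inv g \<otimes> x \<otimes> g = (inv g \<otimes> a \<otimes> g) \<otimes> (inv g \<otimes> b \<otimes> g)"
    using g by (simp add: ab m_assoc flip: m_assoc[of g "inv g"])
  then show "inv g \<otimes> x \<otimes> g \<in> A <#> B"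
    using normal_subset_conj_mem[OF A ab(1) g] normal_subset_conj_mem[OF B ab(2) g]
    by (auto simp: set_mult_def)
qed

text \<open>Moving \<open>a\<close> past \<open>b\<close> replaces \<open>b\<close> by a conjugate,
  which stays in \<open>B\<close>. This lets the argument for \<open>A\<close> be repeated with the
  roles of \<open>A\<close> and \<open>B\<close> exchanged.\<close>

lemma set_mult_normal_subset_commute:
  assumes A: "A \<subseteq> carrier G" and B: "normal_subset G B"
  shows "A <#> B = B <#> A"
proof (intro equalityI subsetI)
  have BG: "B \<subseteq> carrier G"
    using B by (simp add: normal_subset_def)
  {
    fix x assume "x \<in> A <#> B"
    then obtain a b where ab: "a \<in> A" "b \<in> B" "x = a \<otimes> b"
      by (auto simp: set_mult_def)
    with A BG have [simp]: "a \<in> carrier G" "b \<in> carrier G"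
      by auto
    have "a \<otimes> b \<otimes> inv a \<in> B"
      using normal_subset_conj_mem[OF B \<open>b \<in> B\<close>, of "inv a"] by simp
    moreover have "x = (a \<otimes> b \<otimes> inv a) \<otimes> a"
      by (simp add: ab m_assoc)
    ultimately show "x \<in> B <#> A"
      using ab by (auto simp: set_mult_def)
  next
    fix x assume "x \<in> B <#> A"
    then obtain a b where ab: "a \<in> A" "b \<in> B" "x = b \<otimes> a"
      by (auto simp: set_mult_def)
    with A BG have [simp]: "a \<in> carrier G" "b \<in> carrier G"
      by auto
    have "inv a \<otimes> b \<otimes> a \<in> B"
      using normal_subset_conj_mem[OF B \<open>b \<in> B\<close>, of a] by simp
    moreover have "x = a \<otimes> (inv a \<otimes> b \<otimes> a)"
      by (simp add: ab m_assoc flip: m_assoc[of a "inv a"])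
    ultimately show "x \<in> A <#> B"
      using ab by (auto simp: set_mult_def)
  }
qed

text \<open>A rearrangement of \<open>a \<otimes> b \<otimes> c = c \<otimes> a \<otimes> b\<close>.
  The point is that the right-hand side is free of \<open>a\<close>.\<close>

lemma conj_centralizer_set_mult_eq:
  assumes "A \<subseteq> carrier G" "B \<subseteq> carrier G" and c: "c \<in> centralizer G (A <#> B)"
    and "a \<in> A" "b \<in> B"
  shows "inv a \<otimes> c \<otimes> a = b \<otimes> c \<otimes> inv b"
proof -
  have [simp]: "a \<in> carrier G" "b \<in> carrier G" "c \<in> carrier G"
    using assms by (auto simp: centralizer_def)
  have "a \<otimes> b \<in> A <#> B"
    using assms by (auto simp: set_mult_def)
  then have "(a \<otimes> b) \<otimes> c = c \<otimes> (a \<otimes> b)"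
    using c centralizer_iff[OF set_mult_closed[OF assms(1,2)]] by blast
  then have "inv a \<otimes> ((a \<otimes> b) \<otimes> c) \<otimes> inv b = inv a \<otimes> (c \<otimes> (a \<otimes> b)) \<otimes> inv b"
    by simp
  then show ?thesis
    by (simp add: m_assoc flip: m_assoc[of "inv a" a])
qed

text \<open>The core of the argument, for any normal subgroup \<open>N\<close> on which all elements
  of \<open>X\<close> act alike. The common automorphism multiplies each \<open>n\<close> by a
  central factor \<open>w n\<close>, and \<open>w\<close> is multiplicative, so it cannot tell
  \<open>c \<otimes> d\<close> from \<open>d \<otimes> c\<close>.\<close>

lemma commutator_mem_centralizer:
  assumes N: "N \<lhd> G" and X: "normal_subset G X"
    and eq: "\<And>x y n. x \<in> X \<Longrightarrow> y \<in> X \<Longrightarrow> n \<in> N \<Longrightarrow> inv x \<otimes> n \<otimes> x = inv y \<otimes> n \<otimes> y"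
    and c: "c \<in> N" and d: "d \<in> N"
  shows "(c \<otimes> d) \<otimes> inv (d \<otimes> c) \<in> centralizer G X"
proof -
  interpret N: normal N G by fact
  have NG [simp]: "n \<in> carrier G" if "n \<in> N" for n
    using that N.subset by blast
  have XG: "X \<subseteq> carrier G"
    using X by (simp add: normal_subset_def)
  have "x \<otimes> ((c \<otimes> d) \<otimes> inv (d \<otimes> c)) = ((c \<otimes> d) \<otimes> inv (d \<otimes> c)) \<otimes> x" if x: "x \<in> X" for x
  proof -
    have [simp]: "x \<in> carrier G"
      using x XG by blast
    have cancel: "g \<otimes> (inv g \<otimes> h) = h" "inv g \<otimes> (g \<otimes> h) = h"
      if "g \<in> carrier G" "h \<in> carrier G" for g h
      using that by (simp_all flip: m_assoc)
    define \<phi> where "\<phi> n = inv x \<otimes> n \<otimes> x" for n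
    define w where "w n = \<phi> n \<otimes> inv n" for n
    have \<phi>N: "\<phi> n \<in> N" if "n \<in> N" for n
      using that by (simp add: \<phi>_def N.inv_op_closed1)
    have wN: "w n \<in> N" if "n \<in> N" for n
      using that \<phi>N by (simp add: w_def)
    have \<phi>_eq: "\<phi> n = w n \<otimes> n" if "n \<in> N" for n
      using that \<phi>N by (simp add: w_def m_assoc)
    have \<phi>_mult: "\<phi> (m \<otimes> n) = \<phi> m \<otimes> \<phi> n" if "m \<in> N" "n \<in> N" for m n
      using that by (simp add: \<phi>_def m_assoc cancel)
    have w_comm: "w n \<otimes> m = m \<otimes> w n" if n: "n \<in> N" and m: "m \<in> N" for m n
    proof -
      \<comment> \<open>Comparing conjugation by \<open>x\<close> and by \<open>n \<otimes> x \<otimes> inv n\<close> on \<open>x \<otimes> m \<otimes> inv x\<close>.\<close>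
      have y: "n \<otimes> x \<otimes> inv n \<in> X"
        using normal_subset_conj_mem[OF X x, of "inv n"] n by simp
      have k: "x \<otimes> m \<otimes> inv x \<in> N"
        using m by (simp add: N.inv_op_closed2)
      from eq[OF x y k]
      \<comment> \<open>The two conjugating elements differ by \<open>w n\<close>, as
        \<open>n \<otimes> x \<otimes> inv n = x \<otimes> w n\<close>. Since both act alike,
        conjugation by \<open>w n\<close> fixes \<open>m\<close>.\<close>
      have "m = inv (w n) \<otimes> m \<otimes> w n" if "w n = inv x \<otimes> n \<otimes> x \<otimes> inv n"
        using n m that by (simp add: m_assoc cancel inv_mult_group)
      then have "m = inv (w n) \<otimes> m \<otimes> w n"
        by (simp add: w_def \<phi>_def)
      then have "w n \<otimes> m = w n \<otimes> (inv (w n) \<otimes> m \<otimes> w n)"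
        by simp
      then show ?thesis
        using wN n m by (simp add: m_assoc cancel)
    qed
    \<comment> \<open>Centrality of \<open>w n\<close> allows both factors to be collected on the
      left.\<close>
    have \<phi>_prod: "\<phi> (m \<otimes> n) = (w m \<otimes> w n) \<otimes> (m \<otimes> n)" if "m \<in> N" "n \<in> N" for m n
    proof -
      have "\<phi> (m \<otimes> n) = \<phi> m \<otimes> \<phi> n"
        using that by (rule \<phi>_mult)
      also have "\<dots> = w m \<otimes> (m \<otimes> w n) \<otimes> n"
        using that wN by (simp add: \<phi>_eq m_assoc)
      also have "m \<otimes> w n = w n \<otimes> m"
        using that by (simp add: w_comm)
      also have "w m \<otimes> (w n \<otimes> m) \<otimes> n = (w m \<otimes> w n) \<otimes> (m \<otimes> n)"
        using that wN by (simp add: m_assoc)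
      finally show ?thesis .
    qed
    define k where "k = (c \<otimes> d) \<otimes> inv (d \<otimes> c)"
    have kN: "k \<in> N"
      using c d by (simp add: k_def)
    have kdc: "c \<otimes> d = k \<otimes> (d \<otimes> c)"
      using c d by (simp add: k_def m_assoc inv_mult_group cancel)
    have "\<phi> k \<otimes> \<phi> (d \<otimes> c) = \<phi> (c \<otimes> d)"
      using kN c d by (simp add: kdc flip: \<phi>_mult)
    \<comment> \<open>Swapping the central factors gives \<open>c \<otimes> d\<close> the same
      factor that \<open>\<phi>\<close> attaches to \<open>d \<otimes> c\<close>. Cancelling
      \<open>\<phi> (d \<otimes> c)\<close> at the end then leaves
      \<open>\<phi> k = k\<close>.\<close>
    also have "\<dots> = (w d \<otimes> w c) \<otimes> (c \<otimes> d)"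
      by (simp only: \<phi>_prod[OF c d] w_comm[OF c wN[OF d]])
    also have "\<dots> = (w d \<otimes> w c) \<otimes> k \<otimes> (d \<otimes> c)"
      using c d kN wN by (simp add: kdc m_assoc)
    also have "(w d \<otimes> w c) \<otimes> k = k \<otimes> (w d \<otimes> w c)"
      using c d kN wN by (metis NG m_assoc w_comm)
    also have "\<dots> \<otimes> (d \<otimes> c) = k \<otimes> \<phi> (d \<otimes> c)"
      using c d kN wN by (simp add: \<phi>_prod m_assoc)
    finally have "\<phi> k = k"
      using c d kN \<phi>N by simp
    then have "x \<otimes> (inv x \<otimes> k \<otimes> x) = x \<otimes> k"
      by (simp add: \<phi>_def)
    then show ?thesis
      using kN by (simp add: m_assoc cancel flip: k_def)
  qed
  then show ?thesis
    using c d XG by (simp add: centralizer_iff)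
qed

lemma commutator_mem_centralizer_left:
  assumes A: "normal_subset G A" and B: "normal_subset G B" "B \<noteq> {}"
    and cd: "c \<in> centralizer G (A <#> B)" "d \<in> centralizer G (A <#> B)"
  shows "(c \<otimes> d) \<otimes> inv (d \<otimes> c) \<in> centralizer G A"
proof -
  have sub: "A \<subseteq> carrier G" "B \<subseteq> carrier G"
    using A B by (auto simp: normal_subset_def)
  \<comment> \<open>One fixed \<open>b\<close> suffices: conjugating by any element of
    \<open>A\<close> agrees with conjugating by \<open>inv b\<close>.\<close>
  obtain b where b: "b \<in> B"
    using B by blast
  show ?thesis
    using cd conj_centralizer_set_mult_eq[OF sub _ _ b]
    by (intro commutator_mem_centralizer[OF normal_centralizer[OF normal_subset_set_mult[OF A B(1)]] A]) auto
qed

end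

lemma (in normal) comm_group_FactGroupI:
  assumes "\<And>c d. c \<in> carrier G \<Longrightarrow> d \<in> carrier G \<Longrightarrow> (c \<otimes> d) \<otimes> inv (d \<otimes> c) \<in> H"
  shows "comm_group (G Mod H)"
proof (rule group.group_comm_groupI)
  show "group (G Mod H)"
    by (rule factorgroup_is_group)
next
  fix S T assume "S \<in> carrier (G Mod H)" "T \<in> carrier (G Mod H)"
  then obtain c d where "c \<in> carrier G" "S = H #> c" "d \<in> carrier G" "T = H #> d"
    by (auto simp: FactGroup_def RCOSETS_def)
  \<comment> \<open>The commutator lies in \<open>H\<close>, so its coset is \<open>H\<close>
    itself; multiplying by \<open>d \<otimes> c\<close> identifies the two cosets.\<close>
  moreover from this have "H #> (c \<otimes> d) = H #> (d \<otimes> c)"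
    using assms[of c d] subset by (intro coset_mult_inv1 coset_join2 is_subgroup) auto
  ultimately show "S \<otimes>\<^bsub>G Mod H\<^esub> T = T \<otimes>\<^bsub>G Mod H\<^esub> S"
    by (simp add: FactGroup_def rcos_sum)
qed

theorem theoremA:
  fixes G (structure)
  assumes "group G"
    and "finite (carrier G)"
    and "normal_subset G A" and "A \<noteq> {}"
    and "normal_subset G B" and "B \<noteq> {}"
  shows "comm_group ((G\<lparr>carrier := centralizer G (A <#> B)\<rparr>) Mod
           (centralizer G A \<inter> centralizer G B))"
proof -
  interpret group G by fact
  let ?C = "centralizer G (A <#> B)"
  have sub: "A \<subseteq> carrier G" "B \<subseteq> carrier G"
    using assms by (auto simp: normal_subset_def)
  have C: "subgroup ?C G"
    by (intro subgroup_centralizer set_mult_closed sub)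
  have BA: "A <#> B = B <#> A"
    using sub assms by (intro set_mult_normal_subset_commute)
  have "c \<otimes> d \<otimes> inv (d \<otimes> c) \<in> centralizer G A \<inter> centralizer G B"
    if "c \<in> ?C" "d \<in> ?C" for c d
    using that assms commutator_mem_centralizer_left[of A B c d]
      commutator_mem_centralizer_left[of B A c d] by (simp add: BA)
  \<comment> \<open>The quotient forms commutators with the inverse of the restricted group, while
    the membership above uses that of \<open>G\<close>.\<close>
  moreover have "inv\<^bsub>G\<lparr>carrier := ?C\<rparr>\<^esub> g = inv g" if "g \<in> ?C" for g
    using that C by (rule m_inv_consistent[rotated])
  ultimately show ?thesis
    using subgroup.m_closed[OF C] assms
    by (intro normal.comm_group_FactGroupI centralizer_Int_normal) simp_all
qed

end
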